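(* Let $\tau$ be a non-identity permutation of length at least $3$. Then for every $n\ge 1$, the number of permutations of length $n$ sorted to the identity $12\cdots n$ by $s_{\{213,\tau\}}$ is $C_{n-1}$, the $(n-1)$st Catalan number. Moreover, the permutations of length $n$ sorted to the identity by $s_{\{213,\tau\}}$ are exactly those of the form $n\rho$ (the entry $n$ followed by $\rho$), where $\rho$ is a permutation of $\{1,\dots,n-1\}$ avoiding $231$.
   Context: A sequence of distinct integers contains a permutation $\tau$ if some subsequence is order-isomorphic to $\tau$; otherwise it avoids $\tau$. For a set $T$ of permutations, the map $s_T$ is defined by: read the input permutation left to right with an initially empty stack and output; at each step, if there is a next input element and pushing it keeps the stack contents, read from top to bottom, $T$-avoiding, push it; otherwise pop the top of the stack and append it to the output; stop when input and stack are empty; the output is $s_T(\pi)$. $C_m=\frac{1}{m+1}\binom{2m}{m}$. *)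

theory Defs
  imports Complex_Main "HOL-Library.Sublist" "HOL-Combinatorics.Multiset_Permutations"
begin

text \<open>A permutation of length \<open>n\<close> is written in one-line notation, as an element of
  \<^term>\<open>permutations_of_set {1..n::nat}\<close>.\<close>

definition order_isomorphic :: "nat list \<Rightarrow> nat list \<Rightarrow> bool" where
  "order_isomorphic xs ys \<longleftrightarrow> length xs = length ys \<and>
     (\<forall>i < length xs. \<forall>j < length xs. xs ! i < xs ! j \<longleftrightarrow> ys ! i < ys ! j)"

definition contains_pattern :: "nat list \<Rightarrow> nat list \<Rightarrow> bool" where
  "contains_pattern xs \<tau> \<longleftrightarrow> (\<exists>ys. subseq ys xs \<and> order_isomorphic ys \<tau>)"

definition avoids_pattern :: "nat list \<Rightarrow> nat list \<Rightarrow> bool" where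
  "avoids_pattern xs \<tau> \<longleftrightarrow> \<not> contains_pattern xs \<tau>"

definition avoids_patterns :: "nat list \<Rightarrow> nat list set \<Rightarrow> bool" where
  "avoids_patterns xs T \<longleftrightarrow> (\<forall>\<tau>\<in>T. avoids_pattern xs \<tau>)"

text \<open>\<open>stack_run T inp st\<close> is the output still to be produced when the remaining input is \<open>inp\<close>
  and the stack, read from top to bottom, is \<open>st\<close>. In the third equation the value \<open>[]\<close> is a
  dummy for the case where neither a push nor a pop is possible; this can happen only if \<open>T\<close>
  contains a pattern of length at most 1.\<close>

fun stack_run :: "nat list set \<Rightarrow> nat list \<Rightarrow> nat list \<Rightarrow> nat list" where
  "stack_run T [] [] = []"
| "stack_run T [] (y # st) = y # stack_run T [] st"
| "stack_run T (x # inp) [] =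
     (if avoids_patterns [x] T then stack_run T inp [x] else [])"
| "stack_run T (x # inp) (y # st) =
     (if avoids_patterns (x # y # st) T then stack_run T inp (x # y # st)
      else y # stack_run T (x # inp) st)"

definition stack_map :: "nat list set \<Rightarrow> nat list \<Rightarrow> nat list" where
  "stack_map T \<pi> = stack_run T \<pi> []"

definition id_perm :: "nat \<Rightarrow> nat list" where
  "id_perm n = [1..<Suc n]"

definition sorted_perms :: "nat list set \<Rightarrow> nat \<Rightarrow> nat list set" where
  "sorted_perms T n = {\<pi> \<in> permutations_of_set {1..n}. stack_map T \<pi> = id_perm n}"

definition catalan :: "nat \<Rightarrow> real" where
  "catalan m = 1 / (real m + 1) * real ((2 * m) choose m)"

end

theory Submission
  imports Defs
begin

text \<open>The bottom stack entry is never popped before the end, since the forbidden patterns have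
  length at least 3; hence the first entry of a sortable permutation must be \<open>n\<close>. Above \<open>n\<close>, any
  descent of the stack would create the pattern 213, whereas an increasing stack avoids every
  non-identity pattern. The machine therefore runs Knuth's classical stack sort on the remaining
  entries, and this sorts precisely the permutations avoiding 231. These are counted by
  splitting at the maximum, which gives the Catalan recurrence.\<close>

section \<open>Patterns\<close>

lemma set_subseq: "subseq xs ys \<Longrightarrow> set xs \<subseteq> set ys"
  by (auto dest: list_emb_set)

lemma subseq_pair_append_iff:
  "subseq [x, y] (us @ vs) \<longleftrightarrow>
     subseq [x, y] us \<or> x \<in> set us \<and> y \<in> set vs \<or> subseq [x, y] vs"
proof (induction us)
  case (Cons u us)
  then show ?case
    using set_subseq[of "[x, y]" vs] by (auto simp: subseq_singleton_left)
qed simp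

text \<open>The cut of the concatenation falls at one of four places in the triple. This drives
  every case analysis of where an occurrence of 231 lies.\<close>

lemma subseq_triple_append_iff:
  "subseq [x, y, z] (us @ vs) \<longleftrightarrow>
     subseq [x, y, z] us \<or> subseq [x, y] us \<and> z \<in> set vs \<or>
     x \<in> set us \<and> subseq [y, z] vs \<or> subseq [x, y, z] vs"
proof (induction us)
  case (Cons u us)
  then show ?case
    using subseq_Cons'[of x "[y, z]" vs]
    by (auto simp: subseq_singleton_left subseq_pair_append_iff)
qed simp

lemma sorted_wrt_subseq: "subseq ys xs \<Longrightarrow> sorted_wrt R xs \<Longrightarrow> sorted_wrt R ys"
proof (induction rule: list_emb.induct)
  case (list_emb_Cons2 x y xs ys)
  then show ?case using set_subseq by auto
qed auto

lemma contains_pattern_triple_iff: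
  "contains_pattern xs [a, b, c] \<longleftrightarrow>
     (\<exists>x y z. subseq [x, y, z] xs \<and> order_isomorphic [x, y, z] [a, b, c])"
proof
  assume "contains_pattern xs [a, b, c]"
  then obtain ys where ys: "subseq ys xs" "order_isomorphic ys [a, b, c]"
    by (auto simp: contains_pattern_def)
  then have "length ys = Suc (Suc (Suc 0))"
    by (simp add: order_isomorphic_def)
  then obtain x y z where "ys = [x, y, z]"
    by (auto simp: length_Suc_conv)
  with ys show "\<exists>x y z. subseq [x, y, z] xs \<and> order_isomorphic [x, y, z] [a, b, c]"
    by blast
qed (auto simp: contains_pattern_def)

lemma avoids_231_iff:
  "avoids_pattern xs [2, 3, 1] \<longleftrightarrow> (\<forall>x y z. subseq [x, y, z] xs \<longrightarrow> z < x \<longrightarrow> \<not> x < y)"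
proof -
  have "order_isomorphic [x, y, z] [2, 3, 1] \<longleftrightarrow> z < x \<and> x < y" for x y z
    by (auto simp: order_isomorphic_def All_less_Suc)
  then show ?thesis
    by (simp only: avoids_pattern_def contains_pattern_triple_iff) blast
qed

lemma avoids_213_iff:
  "avoids_pattern xs [2, 1, 3] \<longleftrightarrow> (\<forall>x y z. subseq [x, y, z] xs \<longrightarrow> y < x \<longrightarrow> \<not> x < z)"
proof -
  have "order_isomorphic [x, y, z] [2, 1, 3] \<longleftrightarrow> y < x \<and> x < z" for x y z
    by (auto simp: order_isomorphic_def All_less_Suc)
  then show ?thesis
    by (simp only: avoids_pattern_def contains_pattern_triple_iff) blast
qed

lemma sorted_permutation_eq_id_perm:
  assumes "xs \<in> permutations_of_set {1..n}" "sorted xs"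
  shows "xs = id_perm n"
proof -
  have "set (id_perm n) = {1..n}" "sorted (id_perm n)" "distinct (id_perm n)"
    by (simp_all add: id_perm_def atLeastLessThanSuc_atLeastAtMost del: upt_Suc)
  moreover have "set xs = {1..n}" "distinct xs"
    using assms(1) by (simp_all add: permutations_of_set_def)
  ultimately show ?thesis
    using assms(2) by (intro sorted_distinct_set_unique) simp_all
qed

text \<open>An occurrence of \<open>\<tau>\<close> inherits the increase from \<open>xs\<close> and
  passes it on to \<open>\<tau>\<close>, and the only increasing permutation is the
  identity.\<close>

lemma increasing_avoids_non_identity:
  assumes "sorted_wrt (<) xs" "\<tau> \<in> permutations_of_set {1..k}" "\<tau> \<noteq> id_perm k"
  shows "avoids_pattern xs \<tau>"
  unfolding avoids_pattern_def contains_pattern_def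
proof safe
  fix ys assume "subseq ys xs" "order_isomorphic ys \<tau>"
  with assms(1) have "sorted_wrt (<) \<tau>"
    by (auto dest!: sorted_wrt_subseq simp: order_isomorphic_def sorted_wrt_iff_nth_less)
  then have "sorted \<tau>"
    by (simp add: strict_sorted_iff)
  with assms(2,3) show False
    using sorted_permutation_eq_id_perm by blast
qed

lemma short_avoids_pattern:
  assumes "length xs < length \<tau>"
  shows "avoids_pattern xs \<tau>"
  unfolding avoids_pattern_def contains_pattern_def order_isomorphic_def
  using assms list_emb_length by fastforce

section \<open>The stack\<close>

text \<open>Only the dummy branch of \<open>stack_run\<close> loses entries. It needs a singleton
  stack containing a pattern, which length at least 2 excludes.\<close>

lemma mset_stack_run:
  assumes "\<And>\<tau>. \<tau> \<in> T \<Longrightarrow> length \<tau> \<ge> 2"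
  shows "mset (stack_run T inp st) = mset inp + mset st"
  using assms
proof (induction T inp st rule: stack_run.induct)
  case (3 T x inp)
  have "avoids_patterns [x] T"
    unfolding avoids_patterns_def
  proof
    fix \<tau> assume "\<tau> \<in> T"
    from "3.prems"[OF this] show "avoids_pattern [x] \<tau>"
      by (intro short_avoids_pattern) simp
  qed
  with 3 show ?case by simp
qed auto

text \<open>While input remains and \<open>b\<close> is alone on the stack, the next entry can be
  pushed, since two entries contain no pattern of length 3 or more. So \<open>b\<close> is popped
  only after everything else.\<close>

lemma stack_run_bottom_last:
  assumes "\<And>\<tau>. \<tau> \<in> T \<Longrightarrow> length \<tau> \<ge> 3"
  shows "\<exists>out. stack_run T inp (st @ [b]) = out @ [b]"
  using assms
proof (induction T inp "st @ [b]" arbitrary: st rule: stack_run.induct)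
  case (2 T y st')
  then show ?case
    by (cases st) fastforce+
next
  case (4 T x inp y st')
  show ?case
  proof (cases "avoids_patterns (x # y # st') T")
    case True
    with 4 show ?thesis
      by (metis append_Cons stack_run.simps(4))
  next
    case False
    \<comment> \<open>The failed push shows that the stack is not just \<open>[b]\<close>, so the
      popped \<open>y\<close> lies strictly above \<open>b\<close>.\<close>
    have "avoids_patterns [x, b] T"
      unfolding avoids_patterns_def
    proof
      fix \<tau> assume "\<tau> \<in> T"
      from "4.prems"[OF this] show "avoids_pattern [x, b] \<tau>"
        by (intro short_avoids_pattern) simp
    qed
    with False "4.hyps"(3) obtain st'' where st'': "st = y # st''" "st' = st'' @ [b]"
      by (cases st) auto
    from "4.hyps"(2)[OF False st''(2) "4.prems"]
    obtain out where "stack_run T (x # inp) st' = out @ [b]"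
      using st''(2) by auto
    with False have "stack_run T (x # inp) (y # st') = (y # out) @ [b]"
      by simp
    with "4.hyps"(3) show ?thesis by metis
  qed
qed auto

section \<open>Runs above a bottom entry \<open>n\<close>\<close>

lemma push_above_max_iff:
  assumes "\<tau> \<in> permutations_of_set {1..k}" "\<tau> \<noteq> id_perm k"
    and "sorted_wrt (<) (y # st @ [n])" "x < n" "x \<noteq> y"
  shows "avoids_patterns (x # y # st @ [n]) {[2, 1, 3], \<tau>} \<longleftrightarrow> x < y"
proof
  assume "avoids_patterns (x # y # st @ [n]) {[2, 1, 3], \<tau>}"
  then have "avoids_pattern (x # y # st @ [n]) [2, 1, 3]"
    by (simp add: avoids_patterns_def)
  moreover have "subseq [x, y, n] (x # y # st @ [n])"
    by (simp add: subseq_singleton_left)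
  ultimately show "x < y"
    using assms(4,5) by (meson avoids_213_iff linorder_neqE_nat)
next
  assume "x < y"
  with assms(3,4) have sorted: "sorted_wrt (<) (x # y # st @ [n])"
    by (auto simp: sorted_wrt_append)
  \<comment> \<open>213 is itself a non-identity permutation, so one lemma covers both
    patterns.\<close>
  have "[2, 1, 3] \<in> permutations_of_set {1..3::nat}" "[2, 1, 3] \<noteq> id_perm 3"
    by (auto simp: permutations_of_set_def id_perm_def upt_rec)
  with sorted assms(1,2) show "avoids_patterns (x # y # st @ [n]) {[2, 1, 3], \<tau>}"
    by (auto simp: avoids_patterns_def intro: increasing_avoids_non_identity)
qed

text \<open>This describes the pop of \<open>y\<close> forced by a larger next entry
  \<open>x\<close>: in reading order the stack is \<open>rev st @ [y]\<close>. The new condition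
  says that no later entry is smaller than \<open>y\<close>, since such an entry would complete a
  231 with \<open>y\<close> as 2 and \<open>x\<close> as 3.\<close>

lemma decreasing_append_avoids_231_Cons_iff:
  assumes "sorted_wrt (<) (y # st)" "y < x"
  shows "avoids_pattern (rev st @ y # x # inp) [2, 3, 1] \<longleftrightarrow>
    avoids_pattern (rev st @ x # inp) [2, 3, 1] \<and> (\<forall>z \<in> set inp. y \<le> z)"
proof -
  have "sorted_wrt (>) (rev st @ [y])"
    using assms(1) by (auto simp: sorted_wrt_append sorted_wrt_rev)
  then have decreasing: "u > v" if "subseq [u, v] (rev st @ [y])" for u v
    using sorted_wrt_subseq[OF that] by simp
  show ?thesis (is "?L \<longleftrightarrow> ?R")
  proof
    assume ?L
    have "subseq (rev st @ x # inp) (rev st @ y # x # inp)"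
      by (intro list_emb_append_mono) auto
    moreover have "subseq [y, x, z] (rev st @ y # x # inp)" if "z \<in> set inp" for z
      using that by (simp add: subseq_triple_append_iff subseq_singleton_left)
    ultimately show ?R
      using \<open>?L\<close> assms(2) by (meson avoids_231_iff not_less subseq_order.trans)
  next
    assume ?R
    show ?L
      unfolding avoids_231_iff
    proof (intro allI impI notI)
      fix u v w assume sub: "subseq [u, v, w] (rev st @ y # x # inp)" and "w < u" "u < v"
      moreover have "\<not> subseq [u, v, w] (rev st @ x # inp)"
        using \<open>?R\<close> \<open>w < u\<close> \<open>u < v\<close> by (meson avoids_231_iff)
      \<comment> \<open>The occurrence must use \<open>y\<close>. If \<open>y\<close> is not its
        first entry, then its first two entries lie in the decreasing prefix and cannot
        ascend.\<close>
      ultimately consider "u = y" "w \<in> set (x # inp)" | "subseq [u, v] (rev st @ [y])"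
        using set_subseq[of "[v, w]" "x # inp"]
        by (simp only: subseq_triple_append_iff subseq_pair_append_iff subseq_Cons2_iff
            subseq_singleton_left) (auto split: if_splits)
      then show False
        using \<open>?R\<close> assms(2) \<open>w < u\<close> \<open>u < v\<close> decreasing by cases (force, fastforce)
    qed
  qed
qed

text \<open>The invariant list \<open>rev st @ inp\<close> holds the stack in reading order,
  followed by the remaining input. A push leaves it unchanged; a pop deletes one entry, which is
  output in the right place exactly when no smaller entry is still to come.\<close>

lemma sorted_stack_run_above_max_iff:
  assumes \<tau>: "\<tau> \<in> permutations_of_set {1..k}" "\<tau> \<noteq> id_perm k" "k \<ge> 3"
    and "sorted_wrt (<) (st @ [n])" "distinct (inp @ st)" "\<forall>x \<in> set inp. x < n"
  shows "sorted (stack_run {[2, 1, 3], \<tau>} inp (st @ [n])) \<longleftrightarrow>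
    avoids_pattern (rev st @ inp) [2, 3, 1]"
  using assms(4-)
proof (induction inp arbitrary: st)
  case Nil
  have "stack_run {[2, 1, 3], \<tau>} [] s = s" for s
    by (induction s) auto
  moreover have "sorted (st @ [n])"
    using Nil.prems(1) by (simp only: strict_sorted_iff)
  moreover have "avoids_pattern (rev st) [2, 3, 1]"
  proof -
    have "sorted_wrt (>) (rev st)"
      using Nil.prems(1) by (simp add: sorted_wrt_append sorted_wrt_rev)
    from sorted_wrt_subseq[OF _ this] have "v < u" if "subseq [u, v, w] (rev st)" for u v w
      using that by fastforce
    then show ?thesis
      by (meson avoids_231_iff less_asym)
  qed
  ultimately show ?case by simp
next
  case (Cons x inp)
  have len: "length \<sigma> \<ge> 3" if "\<sigma> \<in> {[2, 1, 3], \<tau>}" for \<sigma>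
    using that \<tau>(1,3) by (auto simp: length_finite_permutations_of_set)
  \<comment> \<open>A push shortens the input and uses this hypothesis with a larger stack. A pop
    keeps the input, so it is handled by an inner induction on the stack.\<close>
  note outer = Cons.IH
  from Cons.prems show ?case
  proof (induction st)
    case Nil
    have "avoids_patterns [x, n] {[2, 1, 3], \<tau>}"
      unfolding avoids_patterns_def using len
      by (intro ballI short_avoids_pattern) fastforce
    with outer[of "[x]"] Nil show ?case by auto
  next
    case (Cons y st)
    have sorted: "sorted_wrt (<) (y # st)" and tail: "sorted_wrt (<) (st @ [n])"
      using Cons.prems(1) by (auto simp: sorted_wrt_append)
    have push: "avoids_patterns (x # y # st @ [n]) {[2, 1, 3], \<tau>} \<longleftrightarrow> x < y"
      using Cons.prems by (intro push_above_max_iff[OF \<tau>(1,2)]) auto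
    show ?case
    proof (cases "x < y")
      case True
      have "sorted_wrt (<) ((x # y # st) @ [n])"
        using Cons.prems True by auto
      with outer[of "x # y # st"] push True Cons.prems show ?thesis by auto
    next
      case False
      then have "y < x" using Cons.prems by auto
      \<comment> \<open>The rest of the output consists of exactly the remaining entries. Those in
        \<open>x # st @ [n]\<close> already exceed \<open>y\<close>, so sortedness constrains
        \<open>y\<close> only against \<open>inp\<close>.\<close>
      have "mset (stack_run {[2, 1, 3], \<tau>} (x # inp) (st @ [n])) = mset (x # inp) + mset (st @ [n])"
        using len by (intro mset_stack_run) fastforce
      then have "set (stack_run {[2, 1, 3], \<tau>} (x # inp) (st @ [n])) = set (x # inp @ st @ [n])"
        by (metis append_Cons mset_append set_mset_mset)
      moreover have "\<forall>z \<in> set (x # st @ [n]). y \<le> z"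
        using Cons.prems(1) \<open>y < x\<close> by auto
      ultimately have "sorted (stack_run {[2, 1, 3], \<tau>} (x # inp) ((y # st) @ [n])) \<longleftrightarrow>
          (\<forall>z \<in> set inp. y \<le> z) \<and> avoids_pattern (rev st @ x # inp) [2, 3, 1]"
        using push False Cons.IH tail Cons.prems by auto
      then show ?thesis
        using decreasing_append_avoids_231_Cons_iff[OF sorted \<open>y < x\<close>] by auto
    qed
  qed
qed

section \<open>Counting\<close>

text \<open>Any set of values is allowed, so that the two parts around a maximum can be counted
  without renumbering their entries.\<close>

definition avoiders_231 :: "nat set \<Rightarrow> nat list set" where
  "avoiders_231 A = {xs \<in> permutations_of_set A. avoids_pattern xs [2, 3, 1]}"

lemma finite_avoiders_231: "finite (avoiders_231 A)"
  by (simp add: avoiders_231_def)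

text \<open>With \<open>M\<close> as the 3, any \<open>u\<close> before it and smaller
  \<open>v\<close> after it form a 231. Conversely, an occurrence inside neither part either starts
  at \<open>M\<close>, which nothing exceeds, or starts in \<open>us\<close> and ends in
  \<open>M\<close> or \<open>vs\<close>, hence above its first entry.\<close>

lemma avoids_231_max_split_iff:
  assumes "\<forall>x \<in> set us \<union> set vs. x < M" "set us \<inter> set vs = {}"
  shows "avoids_pattern (us @ M # vs) [2, 3, 1] \<longleftrightarrow>
    avoids_pattern us [2, 3, 1] \<and> avoids_pattern vs [2, 3, 1] \<and>
    (\<forall>u \<in> set us. \<forall>v \<in> set vs. u < v)" (is "?L \<longleftrightarrow> ?R")
proof
  assume ?L
  have "subseq [u, M, v] (us @ M # vs)" if "u \<in> set us" "v \<in> set vs" for u v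
    using that by (simp add: subseq_triple_append_iff subseq_singleton_left)
  with \<open>?L\<close> have "u \<le> v" if "u \<in> set us" "v \<in> set vs" for u v
    using that assms(1) by (meson UnCI avoids_231_iff not_less)
  moreover have "u \<noteq> v" if "u \<in> set us" "v \<in> set vs" for u v
    using that assms(2) by auto
  ultimately have "\<forall>u \<in> set us. \<forall>v \<in> set vs. u < v"
    by (meson le_neq_implies_less)
  moreover have "subseq us (us @ M # vs)" "subseq vs (us @ M # vs)"
    by (auto intro: list_emb_append2)
  ultimately show ?R
    using \<open>?L\<close> by (meson avoids_231_iff subseq_order.trans)
next
  assume ?R
  show ?L
    unfolding avoids_231_iff
  proof (intro allI impI notI)
    fix x y z assume sub: "subseq [x, y, z] (us @ M # vs)" and "z < x" "x < y"
    moreover have "\<not> subseq [x, y, z] us" "\<not> subseq [x, y, z] vs"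
      using \<open>?R\<close> \<open>z < x\<close> \<open>x < y\<close> by (meson avoids_231_iff)+
    ultimately consider "x \<in> set us" "z \<in> insert M (set vs)"
      | "x = M" "y \<in> set vs"
      by (auto simp: subseq_triple_append_iff subseq_singleton_left
          split: if_splits dest!: set_subseq)
    then show False
      using \<open>?R\<close> assms(1) \<open>z < x\<close> \<open>x < y\<close> by cases (auto dest: less_asym)
  qed
qed

text \<open>Turns the order condition of the split into ranges of values: the cut is the least
  element of \<open>B\<close>, or \<open>b\<close> if \<open>B\<close> is empty.\<close>

lemma initial_segment_of_interval:
  fixes a b :: nat
  assumes "A \<union> B = {a..<b}" "a \<le> b" "\<forall>u \<in> A. \<forall>v \<in> B. u < v"
  shows "\<exists>c \<in> {a..b}. A = {a..<c} \<and> B = {c..<b}"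
proof (cases "B = {}")
  case True
  with assms show ?thesis by (intro bexI[of _ b]) auto
next
  case False
  define c where "c = (LEAST v. v \<in> B)"
  have "c \<in> B"
    using False unfolding c_def by (metis LeastI ex_in_conv)
  moreover have "c \<le> v" if "v \<in> B" for v
    using that unfolding c_def by (rule Least_le)
  moreover have mem: "x \<in> A \<or> x \<in> B \<longleftrightarrow> a \<le> x \<and> x < b" for x
    using assms(1) by (auto simp: set_eq_iff)
  ultimately have iffs: "x \<in> A \<longleftrightarrow> a \<le> x \<and> x < c" "x \<in> B \<longleftrightarrow> c \<le> x \<and> x < b" for x
    using assms(3) by (meson le_less_trans less_le_not_le less_trans not_less)+
  have "A = {a..<c}" "B = {c..<b}"
    using iffs by (simp_all add: set_eq_iff)
  moreover have "c \<in> {a..b}"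
    using mem[of c] \<open>c \<in> B\<close> by simp
  ultimately show ?thesis by blast
qed

text \<open>Here \<open>i\<close> counts the entries before the maximum \<open>a + m\<close>;
  avoidance forces them to be the \<open>i\<close> smallest values.\<close>

lemma avoiders_231_Suc_bij:
  "bij_betw (\<lambda>(i, us, vs). us @ (a + m) # vs)
     (SIGMA i:{..m}. avoiders_231 {a..<a + i} \<times> avoiders_231 {a + i..<a + m})
     (avoiders_231 {a..<a + Suc m})"
  (is "bij_betw ?f ?S _")
proof (rule bij_betw_imageI)
  show "inj_on ?f ?S"
  proof (rule inj_onI)
    fix p p' assume "p \<in> ?S" "p' \<in> ?S" "?f p = ?f p'"
    moreover obtain i us vs i' us' vs' where p: "p = (i, us, vs)" "p' = (i', us', vs')"
      by (metis prod_cases3)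
    ultimately have "i \<le> m" and mem: "us \<in> avoiders_231 {a..<a + i}"
        "us' \<in> avoiders_231 {a..<a + i'}" "vs \<in> avoiders_231 {a + i..<a + m}"
      and "us @ (a + m) # vs = us' @ (a + m) # vs'"
      by auto
    \<comment> \<open>The maximum occurs only once, so the list splits at it in one way;
      \<open>i\<close> is then recovered as the length of \<open>us\<close>.\<close>
    moreover have "a + m \<notin> set us" "a + m \<notin> set vs"
      using mem \<open>i \<le> m\<close> by (auto simp: avoiders_231_def permutations_of_set_def)
    ultimately have "us = us' \<and> vs = vs'"
      by (metis append_Cons_eq_iff)
    moreover have "length us = i" "length us' = i'"
      using mem by (auto simp: avoiders_231_def dest!: length_finite_permutations_of_set)
    ultimately show "p = p'"
      using p by simp
  qed
  show "?f ` ?S = avoiders_231 {a..<a + Suc m}"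
  proof (intro equalityI subsetI)
    fix xs assume "xs \<in> ?f ` ?S"
    then obtain i us vs where *: "i \<le> m" "xs = us @ (a + m) # vs"
        "us \<in> avoiders_231 {a..<a + i}" "vs \<in> avoiders_231 {a + i..<a + m}"
      by auto
    then have sets: "set us = {a..<a + i}" "set vs = {a + i..<a + m}" "distinct us" "distinct vs"
      by (auto simp: avoiders_231_def permutations_of_set_def)
    have "avoids_pattern xs [2, 3, 1]"
      unfolding *(2) using * sets
      by (subst avoids_231_max_split_iff) (auto simp: avoiders_231_def)
    moreover have "xs \<in> permutations_of_set {a..<a + Suc m}"
      using * sets by (auto simp: permutations_of_set_def)
    ultimately show "xs \<in> avoiders_231 {a..<a + Suc m}"
      by (simp add: avoiders_231_def)
  next
    fix xs assume xs: "xs \<in> avoiders_231 {a..<a + Suc m}"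
    then have set: "set xs = {a..<a + Suc m}" and "distinct xs"
      and avoids: "avoids_pattern xs [2, 3, 1]"
      by (auto simp: avoiders_231_def permutations_of_set_def)
    then have "a + m \<in> set xs" by auto
    then obtain us vs where split: "xs = us @ (a + m) # vs"
      by (meson split_list)
    have disj: "set us \<inter> set vs = {}" "distinct us" "distinct vs"
      using \<open>distinct xs\<close> split by auto
    have "set us \<union> set vs = set xs - {a + m}"
      using \<open>distinct xs\<close> split by auto
    also have "\<dots> = {a..<a + m}"
      unfolding set by auto
    finally have un: "set us \<union> set vs = {a..<a + m}" .
    then have max: "\<forall>x \<in> set us \<union> set vs. x < a + m"
      by auto
    from avoids have parts: "avoids_pattern us [2, 3, 1]" "avoids_pattern vs [2, 3, 1]"
      and below: "\<forall>u \<in> set us. \<forall>v \<in> set vs. u < v"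
      unfolding split avoids_231_max_split_iff[OF max disj(1)] by auto
    from initial_segment_of_interval[OF un _ below]
    obtain c where "c \<in> {a..a + m}" "set us = {a..<c}" "set vs = {c..<a + m}"
      by auto
    moreover from this obtain i where "c = a + i" "i \<le> m"
      by (metis add_le_cancel_left atLeastAtMost_iff le_Suc_ex)
    ultimately have "(i, us, vs) \<in> ?S"
      using parts disj by (auto simp: avoiders_231_def permutations_of_set_def)
    then show "xs \<in> ?f ` ?S"
      unfolding split by (rule rev_image_eqI) simp
  qed
qed

section \<open>Catalan recurrences\<close>

text \<open>Two applications of the absorption identity for binomials, joined by the symmetry of row
  \<open>2 * m + 1\<close>.\<close>

lemma catalan_Suc: "(real m + 2) * catalan (Suc m) = (4 * real m + 2) * catalan m"
proof -
  have "Suc m * (2 * Suc m choose Suc m) = Suc (2 * m + 1) * ((2 * m + 1) choose m)"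
    using Suc_times_binomial[of m "2 * m + 1"] by simp
  also have "(2 * m + 1) choose m = (2 * m + 1) choose Suc m"
    using binomial_symmetric[of m "2 * m + 1"] by simp
  also have "Suc (2 * m + 1) * ((2 * m + 1) choose Suc m) = 2 * (Suc m * (Suc (2 * m) choose Suc m))"
    by simp
  also have "\<dots> = 2 * (Suc (2 * m) * (2 * m choose m))"
    by (simp only: Suc_times_binomial)
  finally have "real (Suc m * (2 * Suc m choose Suc m)) = real (2 * (Suc (2 * m) * (2 * m choose m)))"
    by (simp only:)
  then have "(real m + 1) * real (2 * Suc m choose Suc m) = (4 * real m + 2) * real (2 * m choose m)"
    by (simp add: algebra_simps del: mult_Suc_right binomial_Suc_Suc)
  then show ?thesis
    by (simp add: catalan_def field_simps del: mult_Suc_right binomial_Suc_Suc)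
qed

text \<open>By symmetry the convolution weighted by \<open>i\<close> is \<open>m / 2\<close> times the unweighted one, so
  the two-term recurrence of the Catalan numbers becomes one for the convolution.\<close>

lemma catalan_convolution: "(\<Sum>i\<le>m. catalan i * catalan (m - i)) = catalan (Suc m)"
proof (induction m)
  case 0
  show ?case by (simp add: catalan_def)
next
  case (Suc m)
  define S where "S m = (\<Sum>i\<le>m. catalan i * catalan (m - i))" for m
  define W where "W m = (\<Sum>i\<le>m. real i * (catalan i * catalan (m - i)))" for m
  have W: "2 * W m = real m * S m" for m
  proof -
    have "W m = (\<Sum>i\<le>m. real (m - i) * (catalan (m - i) * catalan (m - (m - i))))"
      unfolding W_def by (rule sum.reindex_bij_witness[of _ "\<lambda>i. m - i" "\<lambda>i. m - i"]) auto
    also have "\<dots> = (\<Sum>i\<le>m. real m * (catalan i * catalan (m - i)) - real i * (catalan i * catalan (m - i)))"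
      by (intro sum.cong) (auto simp: of_nat_diff algebra_simps)
    also have "\<dots> = real m * S m - W m"
      by (simp add: S_def W_def sum_subtractf sum_distrib_left)
    finally show ?thesis by simp
  qed
  \<comment> \<open>The weight \<open>i + 1\<close> becomes \<open>i + 2\<close> once the index is
    shifted, which is the factor that lets \<open>catalan_Suc\<close> act on each term.\<close>
  have "W (Suc m) + S (Suc m) = (\<Sum>i\<le>Suc m. (real i + 1) * catalan i * catalan (Suc m - i))"
    by (simp only: W_def S_def sum.distrib[symmetric]) (simp add: algebra_simps)
  also have "\<dots> = catalan (Suc m) + (\<Sum>i\<le>m. (real i + 2) * catalan (Suc i) * catalan (m - i))"
    by (subst sum.atMost_Suc_shift) (simp add: catalan_def add.commute)
  also have "\<dots> = catalan (Suc m) + (\<Sum>i\<le>m. (4 * real i + 2) * catalan i * catalan (m - i))"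
    by (simp only: catalan_Suc)
  also have "\<dots> = catalan (Suc m) + 4 * W m + 2 * S m"
    by (simp add: W_def S_def sum_distrib_left sum.distrib[symmetric] algebra_simps)
  \<comment> \<open>Doubling the equation lets \<open>W\<close> eliminate both weighted
    sums.\<close>
  finally have "(real m + 3) * S (Suc m) = 2 * catalan (Suc m) + (4 * real m + 4) * S m"
    using W[of m] W[of "Suc m"] by (simp add: algebra_simps)
  also have "S m = catalan (Suc m)"
    using Suc.IH by (simp add: S_def)
  also have "2 * catalan (Suc m) + (4 * real m + 4) * catalan (Suc m) = (real m + 3) * catalan (Suc (Suc m))"
    using catalan_Suc[of "Suc m"] by (simp add: algebra_simps)
  finally have "S (Suc m) = catalan (Suc (Suc m))"
    using of_nat_0_le_iff[of m, where 'a = real] by (subst (asm) mult_left_cancel) linarith+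
  then show ?case by (simp add: S_def)
qed

text \<open>The start \<open>a\<close> varies because the values after the maximum begin at
  \<open>a + i\<close>; strong induction is used because both parts can have any smaller
  size.\<close>

lemma card_avoiders_231_interval: "real (card (avoiders_231 {a..<a + m})) = catalan m"
proof (induction m arbitrary: a rule: less_induct)
  case (less m)
  show ?case
  proof (cases m)
    case 0
    have "avoiders_231 {} = {[]}"
      by (auto simp: avoiders_231_def intro!: short_avoids_pattern)
    with 0 show ?thesis by (simp add: catalan_def)
  next
    case (Suc m')
    have "card (avoiders_231 {a..<a + m}) =
        card (SIGMA i:{..m'}. avoiders_231 {a..<a + i} \<times> avoiders_231 {a + i..<a + m'})"
      unfolding Suc using bij_betw_same_card[OF avoiders_231_Suc_bij] by metis
    also have "\<dots> = (\<Sum>i\<le>m'. card (avoiders_231 {a..<a + i}) * card (avoiders_231 {a + i..<a + m'}))"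
      by (subst card_SigmaI) (auto simp: finite_avoiders_231 card_cartesian_product)
    finally have "real (card (avoiders_231 {a..<a + m})) =
        (\<Sum>i\<le>m'. real (card (avoiders_231 {a..<a + i})) * real (card (avoiders_231 {a + i..<a + m'})))"
      by simp
    also have "\<dots> = (\<Sum>i\<le>m'. catalan i * catalan (m' - i))"
    proof (rule sum.cong)
      fix i assume "i \<in> {..m'}"
      then show "real (card (avoiders_231 {a..<a + i})) * real (card (avoiders_231 {a + i..<a + m'})) =
          catalan i * catalan (m' - i)"
        using less.IH[of i a] less.IH[of "m' - i" "a + i"] Suc by simp
    qed simp
    also have "\<dots> = catalan m"
      by (simp add: catalan_convolution Suc)
    finally show ?thesis .
  qed
qed

section \<open>Characterization and count of the sorted permutations\<close>

lemma stack_map_eq_id_perm_iff: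
  assumes "\<tau> \<in> permutations_of_set {1..k}" "k \<ge> 3" "\<tau> \<noteq> id_perm k" "n \<ge> 1"
    and \<pi>: "\<pi> \<in> permutations_of_set {1..n}"
  shows "stack_map {[2, 1, 3], \<tau>} \<pi> = id_perm n \<longleftrightarrow>
    (\<exists>\<rho>. \<pi> = n # \<rho> \<and> avoids_pattern \<rho> [2, 3, 1])"
proof -
  let ?T = "{[2, 1, 3], \<tau>}"
  have len: "length \<sigma> \<ge> 3" if "\<sigma> \<in> ?T" for \<sigma>
    using that assms(1,2) by (auto simp: length_finite_permutations_of_set)
  obtain x \<rho> where x\<rho>: "\<pi> = x # \<rho>"
    using \<pi> assms(4) by (cases \<pi>) (auto simp: permutations_of_set_def)
  have run: "stack_map ?T \<pi> = stack_run ?T \<rho> [x]"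
  proof -
    have "avoids_patterns [x] ?T"
      unfolding avoids_patterns_def using len
      by (intro ballI short_avoids_pattern) fastforce
    then show ?thesis by (simp add: stack_map_def x\<rho>)
  qed
  have "mset (stack_run ?T \<rho> [x]) = mset \<pi>"
    using len by (subst mset_stack_run) (fastforce simp: x\<rho>)+
  then have perm: "stack_run ?T \<rho> [x] \<in> permutations_of_set {1..n}"
    using \<pi> by (metis (lifting) mem_Collect_eq mset_eq_imp_distinct_iff mset_eq_setD permutations_of_set_def)
  \<comment> \<open>The output is a permutation of \<open>{1..n}\<close>, so being sorted already
    makes it the identity.\<close>
  have sorted_iff: "stack_run ?T \<rho> [x] = id_perm n \<longleftrightarrow> sorted (stack_run ?T \<rho> [x])"
    using sorted_permutation_eq_id_perm[OF perm] by (auto simp: id_perm_def simp del: upt_Suc)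
  have first: "x = n" if "stack_run ?T \<rho> [x] = id_perm n"
  proof -
    obtain out where "stack_run ?T \<rho> ([] @ [x]) = out @ [x]"
      using stack_run_bottom_last[of ?T \<rho> "[]" x] len by blast
    with that have "out @ [x] = id_perm n" by simp
    then show ?thesis
      using assms(4) by (simp add: id_perm_def)
  qed
  have "sorted (stack_run ?T \<rho> [n]) \<longleftrightarrow> avoids_pattern \<rho> [2, 3, 1]" if "x = n"
  proof -
    have "\<forall>y \<in> set \<rho>. y < n"
      using \<pi> that by (fastforce simp: x\<rho> permutations_of_set_def le_less)
    \<comment> \<open>With nothing above \<open>n\<close> yet, the invariant list is
      \<open>\<rho>\<close> itself.\<close>
    then show ?thesis
      using sorted_stack_run_above_max_iff[OF assms(1,3,2), of "[]" n \<rho>] \<pi>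
      by (auto simp: x\<rho> permutations_of_set_def)
  qed
  then show ?thesis
    using run sorted_iff first x\<rho> by auto
qed

theorem theorem3p3:
  fixes \<tau> :: "nat list" and k n :: nat
  assumes "\<tau> \<in> permutations_of_set {1..k}"
    and "k \<ge> 3"
    and "\<tau> \<noteq> id_perm k"
    and "n \<ge> 1"
  shows "real (card (sorted_perms {[2, 1, 3], \<tau>} n)) = catalan (n - 1) \<and>
    sorted_perms {[2, 1, 3], \<tau>} n =
      {n # \<rho> | \<rho>. \<rho> \<in> permutations_of_set {1..n - 1} \<and> avoids_pattern \<rho> [2, 3, 1]}"
proof -
  have Cons_iff: "n # \<rho> \<in> permutations_of_set {1..n} \<longleftrightarrow> \<rho> \<in> permutations_of_set {1..n - 1}" for \<rho>
  proof -
    have "{1..n} = insert n {1..n - 1}" "n \<notin> {1..n - 1}"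
      using assms(4) by auto
    then show ?thesis
      by (auto simp: permutations_of_set_def insert_ident)
  qed
  have eq: "sorted_perms {[2, 1, 3], \<tau>} n =
      {n # \<rho> | \<rho>. \<rho> \<in> permutations_of_set {1..n - 1} \<and> avoids_pattern \<rho> [2, 3, 1]}"
    unfolding sorted_perms_def using stack_map_eq_id_perm_iff[OF assms] Cons_iff by blast
  also have "\<dots> = (#) n ` avoiders_231 {1..<1 + (n - 1)}"
  proof -
    \<comment> \<open>The half-open form fits the interval count with \<open>a = 1\<close>;
      prepending \<open>n\<close> is injective and preserves cardinality.\<close>
    have "{1..<1 + (n - 1)} = {1..n - 1}" by auto
    then show ?thesis by (auto simp: avoiders_231_def)
  qed
  finally have "real (card (sorted_perms {[2, 1, 3], \<tau>} n)) = catalan (n - 1)"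
    using card_avoiders_231_interval[of 1 "n - 1"] by (simp add: card_image)
  with eq show ?thesis by blast
qed

end
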